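(* Let $p>2$ be a prime, let $t$ be a positive divisor of $p-1$ and let $k$ be an integer with $1<k\le(p/2)^{1/2}$. Put $r_1(k)=\left\lfloor \frac{\log(p/2)}{2\log k}\right\rfloor$ and $s=s_1(k,t)=\max\left\{s'\in\mathbb{Z}_{\ge0}~:~\binom{r_1(k)+s'}{s'}\le t\right\}$. Then $$\#\{|x|~:~x\in V(k,t,1)\}\le\tilde\Phi(k,s).$$
   Context: $\mathbb{F}_p$ is the field of residues modulo $p$. For $x\in\mathbb{F}_p$, the integer height is $|x|=\min\{|a|~:~a\in\mathbb{Z},\ a\equiv x\pmod p\}$ and the rational height is $\|x\|=\min\{\max(|a|,b)~:~a\in\mathbb{Z},\ b\in\mathbb{N},\ a\equiv bx \pmod p\}$. For $t\mid p-1$, $G$ is the unique subgroup of $\mathbb{F}_p^*$ of order $t$ and $V(k,t,1)=\{x\in G~:~\|x\|\le k\}$. $\Psi(x,y)$ is the number of positive integers $n\le x$ all of whose prime factors are at most $y$; $p_j$ is the $j$-th prime ($p_1=2$), with the convention $\Psi(x,p_0)=1$ for $x\ge 1$. For $s\in\mathbb{N}$, $\tilde\Phi(k,s)=\sum_{i=0}^{s}\binom{s}{i}\Psi(k,p_i)\Psi(k,p_{s-i})$, and $\tilde\Phi(k,0)=1$. *)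

theory Defs
  imports "HOL-Number_Theory.Number_Theory" "HOL-Algebra.Multiplicative_Group" Complex_Main
begin

text \<open>The field of residues modulo p is \<^term>\<open>residue_ring (int p)\<close>, whose elements are
  the integers \<open>0, \<dots>, p - 1\<close>.\<close>

definition integer_height :: "nat \<Rightarrow> int \<Rightarrow> nat" where
  "integer_height p x = (LEAST h. \<exists>a::int. [a = x] (mod int p) \<and> h = nat \<bar>a\<bar>)"

text \<open>The denominator \<open>b\<close> ranges over the positive integers; allowing \<open>b = 0\<close> would make
  every height zero.\<close>

definition rational_height :: "nat \<Rightarrow> int \<Rightarrow> nat" where
  "rational_height p x =
     (LEAST h. \<exists>(a::int) (b::nat). b > 0 \<and> [a = int b * x] (mod int p) \<and> h = max (nat \<bar>a\<bar>) b)"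

definition subgroup_of_order :: "nat \<Rightarrow> nat \<Rightarrow> int set" where
  "subgroup_of_order p t =
     (THE G. subgroup G (mult_of (residue_ring (int p))) \<and> card G = t)"

lemma ex1_subgroup_of_order:
  assumes "prime p" "t dvd p - 1"
  shows "\<exists>!G. subgroup G (mult_of (residue_ring (int p))) \<and> card G = t"
proof -
  define R where "R = residue_ring (int p)"
  interpret residues_prime p R
    by unfold_locales (use assms(1) in \<open>simp_all add: R_def\<close>)
  interpret M: group "mult_of R"
    rewrites "([^]\<^bsub>mult_of R\<^esub>) = (([^]\<^bsub>R\<^esub>) :: _ \<Rightarrow> nat \<Rightarrow> _)" and "\<one>\<^bsub>mult_of R\<^esub> = \<one>\<^bsub>R\<^esub>"
    by (rule field_mult_group) (simp_all add: fun_eq_iff nat_pow_mult_of)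
  have fin: "finite (carrier R)" by (simp add: R_def residue_ring_def)
  have p1: "p > 1" using assms(1) prime_gt_1_nat by blast
  have "t \<noteq> 0" using assms(2) p1 by (metis dvd_0_left zero_less_diff less_irrefl)
  have ord: "order (mult_of R) = p - 1"
    using order_mult_of[OF fin] p1 by (simp add: order_def R_def residue_ring_def)
  define T where "T = {x \<in> carrier R. x [^]\<^bsub>R\<^esub> t = \<one>\<^bsub>R\<^esub>}"
  have finT: "finite T" using fin by (simp add: T_def)
  have cardT: "card T \<le> t"
    unfolding T_def by (rule num_roots_le_deg[OF fin \<open>t \<noteq> 0\<close>])
  have eqT: "G = T" if G: "subgroup G (mult_of R)" "card G = t" for G
  proof -
    have sub: "G \<subseteq> carrier (mult_of R)" using G(1) subgroup.subset by blast
    have "G \<subseteq> T"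
    proof
      fix x assume x: "x \<in> G"
      interpret K: group "(mult_of R)\<lparr>carrier := G\<rparr>"
        using G(1) M.subgroup_imp_group by blast
      have "x [^]\<^bsub>(mult_of R)\<lparr>carrier := G\<rparr>\<^esub> order ((mult_of R)\<lparr>carrier := G\<rparr>)
              = \<one>\<^bsub>(mult_of R)\<lparr>carrier := G\<rparr>\<^esub>"
        using x by (intro K.pow_order_eq_1) simp
      then have "x [^]\<^bsub>R\<^esub> t = \<one>\<^bsub>R\<^esub>"
        using G(2) by (simp add: order_def nat_pow_def)
      with x sub show "x \<in> T" by (auto simp: T_def)
    qed
    then show ?thesis using finT cardT G(2) by (metis card_seteq)
  qed
  obtain g where g: "g \<in> carrier (mult_of R)"
    and gen: "carrier (mult_of R) = {g [^]\<^bsub>R\<^esub> i | i::nat. i \<in> UNIV}"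
    using finite_field_mult_group_has_gen[OF fin] by blast
  have "generate (mult_of R) {g} = carrier (mult_of R)"
  proof
    show "generate (mult_of R) {g} \<subseteq> carrier (mult_of R)"
      using g by (intro M.generate_incl) simp
    have "g [^]\<^bsub>R\<^esub> i \<in> generate (mult_of R) {g}" for i :: nat
    proof (induction i)
      case 0
      show ?case using generate.one[of "mult_of R" "{g}"] by simp
    next
      case (Suc i)
      then show ?case
        using generate.eng[OF Suc generate.incl[of g "{g}" "mult_of R"]] by simp
    qed
    then show "carrier (mult_of R) \<subseteq> generate (mult_of R) {g}" using gen by auto
  qed
  then have ordg: "group.ord (mult_of R) g = p - 1"
    using M.generate_pow_card[OF g] ord by (simp add: order_def)
  define a where "a = g [^]\<^bsub>R\<^esub> ((p - 1) div t)"
  have a: "a \<in> carrier (mult_of R)" "group.ord (mult_of R) a = t"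
  proof -
    show "a \<in> carrier (mult_of R)" using gen by (auto simp: a_def)
    obtain c where c: "p - 1 = t * c" using assms(2) by blast
    have "c \<noteq> 0" using c p1 by (metis mult_0_right zero_less_diff less_irrefl)
    with c \<open>t \<noteq> 0\<close> show "group.ord (mult_of R) a = t"
      using M.ord_pow[OF g, of c] ordg by (simp add: a_def)
  qed
  have "subgroup (generate (mult_of R) {a}) (mult_of R)"
    using a(1) by (intro M.generate_is_subgroup) simp
  moreover have "card (generate (mult_of R) {a}) = t"
    using M.generate_pow_card[OF a(1)] a(2) by simp
  ultimately show ?thesis using eqT unfolding R_def by blast
qed

definition V1 :: "nat \<Rightarrow> nat \<Rightarrow> nat \<Rightarrow> int set" where
  "V1 p k t = {x \<in> subgroup_of_order p t. rational_height p x \<le> k}"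

definition Psi :: "real \<Rightarrow> real \<Rightarrow> nat" where
  "Psi x y = card {n::nat. n > 0 \<and> real n \<le> x \<and> (\<forall>q. prime q \<and> q dvd n \<longrightarrow> real q \<le> y)}"

text \<open>Primes are indexed from \<open>1\<close>, so \<open>nth_prime 1 = 2\<close>; the value at \<open>0\<close> is never used.\<close>

definition nth_prime :: "nat \<Rightarrow> nat" where
  "nth_prime j = enumerate {q::nat. prime q} (j - 1)"

text \<open>\<open>Psi_prime x j\<close> is \<open>\<Psi>(x, p\<^sub>j)\<close>, with the convention \<open>\<Psi>(x, p\<^sub>0) = 1\<close> for \<open>x \<ge> 1\<close>.\<close>

definition Psi_prime :: "real \<Rightarrow> nat \<Rightarrow> nat" where
  "Psi_prime x j = (if j = 0 then 1 else Psi x (real (nth_prime j)))"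

definition Phi_tilde :: "nat \<Rightarrow> nat \<Rightarrow> nat" where
  "Phi_tilde k s = (\<Sum>i = 0..s. (s choose i) * Psi_prime (real k) i * Psi_prime (real k) (s - i))"

lemma Phi_tilde_0: "Phi_tilde k 0 = 1"
  by (simp add: Phi_tilde_def Psi_prime_def)

definition r1 :: "nat \<Rightarrow> nat \<Rightarrow> nat" where
  "r1 p k = nat \<lfloor>ln (real p / 2) / (2 * ln (real k))\<rfloor>"

text \<open>For \<open>r1 p k \<ge> 1\<close> and \<open>t \<ge> 1\<close> the set below is finite and contains \<open>0\<close>, so
  \<^const>\<open>Max\<close> is its genuine maximum.\<close>

definition s1 :: "nat \<Rightarrow> nat \<Rightarrow> nat \<Rightarrow> nat" where
  "s1 p k t = Max {s'. (r1 p k + s') choose s' \<le> t}"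

end

theory Submission
  imports Defs "HOL-Library.Function_Algebras"
begin

text \<open>Lift each \<open>x \<in> V(k,t,1)\<close> to a fraction \<open>c\<close> with numerator and denominator at most \<open>k\<close>;
  if \<open>|c| = |d|\<close>, the residues of \<open>c\<close> and \<open>d\<close> agree up to sign. A multiplicatively independent set
  of \<open>m\<close> such fractions has \<open>binom(r + m, m)\<close> distinct monomials of degree at most \<open>r = r\<^sub>1(k)\<close>.
  Their numerators and denominators are at most \<open>k^r\<close>, and \<open>2 k^(2r) < p\<close>, so they remain distinct
  modulo \<open>p\<close>, where they lie in \<open>G\<close>; hence \<open>m \<le> s\<close>. So the exponent vectors of the fractions span a
  space of dimension at most \<open>s\<close> and are determined by their coordinates at some \<open>s\<close> primes: \<open>|c|\<close> is
  determined by the parts \<open>u, v \<le> k\<close> of its numerator and denominator composed of these primes.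
  As \<open>u\<close> and \<open>v\<close> are coprime, splitting the \<open>s\<close> primes into those dividing \<open>u\<close> and the others, and
  replacing each group by the smallest primes, bounds the number of pairs by \<open>Phi_tilde k s\<close>.\<close>

subsection \<open>Determining functionals\<close>

definition determining_functionals :: "('i \<Rightarrow> 'v \<Rightarrow> 'a::zero) \<Rightarrow> 'i set \<Rightarrow> 'i set \<Rightarrow> 'v set \<Rightarrow> bool" where
  "determining_functionals \<phi> I J U \<longleftrightarrow>
     J \<subseteq> I \<and> finite J \<and> (\<forall>u\<in>U. (\<forall>j\<in>J. \<phi> j u = 0) \<longrightarrow> (\<forall>i\<in>I. \<phi> i u = 0))"

text \<open>Adjoining \<open>b\<close> to \<open>B\<close> enlarges the subspace of \<open>span B\<close> on which all \<open>\<phi> j\<close> vanish by at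
  most one dimension, so one further functional suffices.\<close>

lemma (in vector_space) determining_functionals_span_insert:
  assumes lin: "\<And>i. i \<in> I \<Longrightarrow> Vector_Spaces.linear scale (*) (\<phi> i)"
    and J: "determining_functionals \<phi> I J (span B)"
    and w: "w \<in> span (insert b B)" "\<forall>j\<in>J. \<phi> j w = 0" and i: "i \<in> I" "\<phi> i w \<noteq> 0"
  shows "determining_functionals \<phi> I (insert i J) (span (insert b B))"
proof -
  note diff = module_hom.diff[OF Vector_Spaces.linear.axioms(3)[OF lin]]
    and scale = module_hom.scale[OF Vector_Spaces.linear.axioms(3)[OF lin]]
  have sub: "J \<subseteq> I" "finite J"
    and det: "\<And>u. u \<in> span B \<Longrightarrow> \<forall>j\<in>J. \<phi> j u = 0 \<Longrightarrow> \<forall>i\<in>I. \<phi> i u = 0"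
    using J unfolding determining_functionals_def by blast+
  obtain c where c: "w - scale c b \<in> span B" using w(1) by (auto simp: span_breakdown_eq)
  have "\<forall>i\<in>I. \<phi> i u = 0"
    if u: "u \<in> span (insert b B)" and vanish: "\<forall>j\<in>insert i J. \<phi> j u = 0" for u
  proof -
    obtain d where d: "u - scale d b \<in> span B" using u by (auto simp: span_breakdown_eq)
    have "scale c (u - scale d b) - scale d (w - scale c b) \<in> span B"
      using c d by (intro span_diff[OF span_scale span_scale])
    then have "scale c u - scale d w \<in> span B"
      by (simp add: scale_right_diff_distrib mult.commute[of d c])
    then have "\<forall>i\<in>I. \<phi> i (scale c u - scale d w) = 0"
      using sub(1) w(2) vanish by (intro det) (auto simp: subset_iff diff scale)
    then have "\<phi> i (scale c u - scale d w) = 0" using i(1) by blast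
    then have "d = 0" using i vanish by (simp add: diff scale)
    then have "u \<in> span B" using d by simp
    then show ?thesis using vanish by (intro det) auto
  qed
  then show ?thesis using sub i(1) unfolding determining_functionals_def by blast
qed

lemma (in vector_space) obtain_determining_functionals:
  assumes "finite B" and lin: "\<And>i. i \<in> I \<Longrightarrow> Vector_Spaces.linear scale (*) (\<phi> i)"
  obtains J where "determining_functionals \<phi> I J (span B)" "card J \<le> card B"
proof -
  have "\<exists>J. determining_functionals \<phi> I J (span B) \<and> card J \<le> card B"
    using assms(1)
  proof (induction B rule: finite_induct)
    case empty
    then show ?case
      using module_hom.zero[OF Vector_Spaces.linear.axioms(3)[OF lin]]
      by (intro exI[of _ "{}"]) (simp add: determining_functionals_def)
  next
    case (insert b B)
    then obtain J where J: "determining_functionals \<phi> I J (span B)" "card J \<le> card B" by blast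
    show ?case
    proof (cases "determining_functionals \<phi> I J (span (insert b B))")
      case True
      then show ?thesis using J insert.hyps by (intro exI[of _ J]) simp
    next
      case False
      then obtain w i where w: "w \<in> span (insert b B)" "\<forall>j\<in>J. \<phi> j w = 0" "i \<in> I" "\<phi> i w \<noteq> 0"
        using J(1) unfolding determining_functionals_def by blast
      have "determining_functionals \<phi> I (insert i J) (span (insert b B))"
        using lin J(1) w by (rule determining_functionals_span_insert)
      moreover have "finite J" using J(1) by (simp add: determining_functionals_def)
      then have "card (insert i J) \<le> card (insert b B)"
        using J(2) insert.hyps by (simp add: card_insert_if le_SucI)
      ultimately show ?thesis by blast
    qed
  qed
  then show thesis using that by blast
qed

interpretation fun_space: vector_space "\<lambda>(c :: 'a :: field) (f :: 'b \<Rightarrow> 'a) i. c * f i"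
  by unfold_locales (auto simp: fun_eq_iff algebra_simps)

lemma linear_evaluation:
  "Vector_Spaces.linear (\<lambda>(c :: 'a :: field) (f :: 'b \<Rightarrow> 'a) i. c * f i) (*) (\<lambda>f. f i)"
  by unfold_locales (auto simp: algebra_simps)

subsection \<open>Exponent vectors of rational numbers\<close>

definition numer :: "rat \<Rightarrow> nat" where
  "numer c = nat \<bar>fst (quotient_of c)\<bar>"

definition denom :: "rat \<Rightarrow> nat" where
  "denom c = nat (snd (quotient_of c))"

lemma denom_pos: "denom c > 0"
  using quotient_of_denom_pos'[of c] by (simp add: denom_def)

lemma coprime_numer_denom: "coprime (numer c) (denom c)"
proof -
  have "coprime (fst (quotient_of c)) (snd (quotient_of c))"
    by (rule quotient_of_coprime) simp
  then show ?thesis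
    using quotient_of_denom_pos'[of c]
    by (simp add: numer_def denom_def flip: coprime_int_iff)
qed

lemma abs_eq_numer_div_denom: "\<bar>c\<bar> = of_nat (numer c) / of_nat (denom c)"
proof -
  have "c = of_int (fst (quotient_of c)) / of_int (snd (quotient_of c))"
    by (rule quotient_of_div) simp
  then have "\<bar>c\<bar> = \<bar>of_int (fst (quotient_of c)) / of_int (snd (quotient_of c))\<bar>" by simp
  then show ?thesis
    using quotient_of_denom_pos'[of c] by (simp add: numer_def denom_def)
qed

lemma numer_pos_iff: "numer c > 0 \<longleftrightarrow> c \<noteq> 0"
  using abs_eq_numer_div_denom[of c] denom_pos[of c] by (cases "numer c = 0") auto

lemma numer_mult_eq:
  assumes "\<bar>c\<bar> = of_nat m / of_nat n" and "n > 0"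
  shows "numer c * n = m * denom c"
proof -
  have "(of_nat (numer c * n) :: rat) = of_nat (m * denom c)"
    using assms abs_eq_numer_div_denom[of c] denom_pos[of c] by (simp add: field_simps)
  then show ?thesis by (simp only: of_nat_eq_iff)
qed

lemma numer_denom_dvd:
  assumes "\<bar>c\<bar> = of_nat m / of_nat n" and "n > 0"
  shows "numer c dvd m" and "denom c dvd n"
proof -
  have "numer c dvd m * denom c" using numer_mult_eq[OF assms] by (metis dvd_triv_left)
  then show "numer c dvd m" using coprime_numer_denom by (simp add: coprime_dvd_mult_left_iff)
  have "denom c dvd numer c * n" using numer_mult_eq[OF assms] by (metis dvd_triv_right)
  then show "denom c dvd n"
    using coprime_numer_denom by (simp add: coprime_dvd_mult_right_iff coprime_commute)
qed

definition exponent_vector :: "rat \<Rightarrow> nat \<Rightarrow> rat" where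
  "exponent_vector c q = of_nat (count (prime_factorization (numer c)) q)
     - of_nat (count (prime_factorization (denom c)) q)"

lemma exponent_vector_nonprime: "\<not> prime q \<Longrightarrow> exponent_vector c q = 0"
  by (simp add: exponent_vector_def count_prime_factorization_nonprime)

lemma exponent_vector_fraction:
  assumes "\<bar>c\<bar> = of_nat m / of_nat n" "m > 0" "n > 0"
  shows "exponent_vector c q =
    of_nat (count (prime_factorization m) q) - of_nat (count (prime_factorization n) q)"
proof -
  have "c \<noteq> 0" using assms by auto
  then have "prime_factorization (numer c) + prime_factorization n
      = prime_factorization m + prime_factorization (denom c)"
    using numer_mult_eq[OF assms(1,3)] assms(2,3) denom_pos[of c] numer_pos_iff[of c]
    by (simp flip: prime_factorization_mult)
  then have "count (prime_factorization (numer c)) q + count (prime_factorization n) q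
      = count (prime_factorization m) q + count (prime_factorization (denom c)) q"
    by (metis count_union)
  then have "(of_nat (count (prime_factorization (numer c)) q
        + count (prime_factorization n) q) :: rat)
      = of_nat (count (prime_factorization m) q + count (prime_factorization (denom c)) q)"
    by (rule arg_cong)
  then show ?thesis by (simp add: exponent_vector_def algebra_simps)
qed

lemma exponent_vector_mult:
  assumes "c \<noteq> 0" "d \<noteq> 0"
  shows "exponent_vector (c * d) = exponent_vector c + exponent_vector d"
proof
  fix q
  have pos: "numer c > 0" "numer d > 0" "denom c > 0" "denom d > 0"
    using assms by (simp_all add: numer_pos_iff denom_pos)
  have "\<bar>c * d\<bar> = of_nat (numer c * numer d) / of_nat (denom c * denom d)"
    by (simp add: abs_mult abs_eq_numer_div_denom[of c] abs_eq_numer_div_denom[of d])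
  then have "exponent_vector (c * d) q = of_nat (count (prime_factorization (numer c * numer d)) q)
      - of_nat (count (prime_factorization (denom c * denom d)) q)"
    using pos by (intro exponent_vector_fraction) simp_all
  then show "exponent_vector (c * d) q = (exponent_vector c + exponent_vector d) q"
    using pos by (simp add: exponent_vector_def prime_factorization_mult)
qed

lemma exponent_vector_1 [simp]: "exponent_vector 1 = 0"
  by (simp add: exponent_vector_def numer_def denom_def fun_eq_iff)

lemma abs_eq_if_exponent_vector_eq:
  assumes "c \<noteq> 0" "d \<noteq> 0" "exponent_vector c = exponent_vector d"
  shows "\<bar>c\<bar> = \<bar>d\<bar>"
proof -
  have pos: "numer c > 0" "numer d > 0" "denom c > 0" "denom d > 0"
    using assms by (simp_all add: numer_pos_iff denom_pos)
  have "count (prime_factorization (numer c * denom d)) q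
      = count (prime_factorization (numer d * denom c)) q" for q
  proof -
    have "(of_nat (count (prime_factorization (numer c)) q
          + count (prime_factorization (denom d)) q) :: rat)
        = of_nat (count (prime_factorization (numer d)) q
          + count (prime_factorization (denom c)) q)"
      using fun_cong[OF assms(3), of q] by (simp add: exponent_vector_def algebra_simps)
    then show ?thesis
      unfolding of_nat_eq_iff using pos by (simp add: prime_factorization_mult)
  qed
  then have "numer c * denom d = numer d * denom c"
    using pos prime_factorization_unique[of "numer c * denom d" "numer d * denom c"]
    by (simp add: multiset_eq_iff)
  then have "(of_nat (numer c) * of_nat (denom d) :: rat) = of_nat (numer d) * of_nat (denom c)"
    by (metis of_nat_mult)
  then show ?thesis using pos by (simp add: abs_eq_numer_div_denom frac_eq_eq)
qed

lemma exponent_vector_prod_mset: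
  assumes "finite B" "0 \<notin> B" "set_mset A \<subseteq> B"
  shows "exponent_vector (prod_mset A) = (\<Sum>c\<in>B. (\<lambda>q. of_nat (count A c) * exponent_vector c q))"
  using assms(3)
proof (induction A)
  case empty
  show ?case by (simp add: fun_eq_iff)
next
  case (add d A)
  have "d \<noteq> 0" "prod_mset A \<noteq> 0" using add.prems assms(2) by auto
  then have "exponent_vector (prod_mset (add_mset d A))
      = exponent_vector d + (\<Sum>c\<in>B. (\<lambda>q. of_nat (count A c) * exponent_vector c q))"
    using add by (simp add: exponent_vector_mult)
  also have "exponent_vector d = (\<Sum>c\<in>B. if c = d then exponent_vector d else 0)"
    using add.prems assms(1) by simp
  also have "\<dots> + (\<Sum>c\<in>B. (\<lambda>q. of_nat (count A c) * exponent_vector c q))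
      = (\<Sum>c\<in>B. (\<lambda>q. of_nat (count (add_mset d A) c) * exponent_vector c q))"
    unfolding sum.distrib[symmetric] by (intro sum.cong) (auto simp: fun_eq_iff algebra_simps)
  finally show ?case .
qed

definition mult_independent :: "'a::comm_monoid_mult set \<Rightarrow> bool" where
  "mult_independent B \<longleftrightarrow> inj_on prod_mset {A. set_mset A \<subseteq> B}"

lemma mult_independent_if_exponent_vectors_independent:
  assumes B: "finite B" "0 \<notin> B" and inj: "inj_on exponent_vector B"
    and indep: "fun_space.independent (exponent_vector ` B)"
  shows "mult_independent B"
  unfolding mult_independent_def
proof (rule inj_onI, clarify)
  fix A A' assume A: "set_mset A \<subseteq> B" and A': "set_mset A' \<subseteq> B"
    and eq: "prod_mset A = prod_mset A'"
  define u where "u v = (let c = inv_into B exponent_vector v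
    in of_nat (count A c) - of_nat (count A' c) :: rat)" for v
  have u: "u (exponent_vector c) = of_nat (count A c) - of_nat (count A' c)" if "c \<in> B" for c
    using inj that by (simp add: u_def)
  have "(\<Sum>v\<in>exponent_vector ` B. (\<lambda>q. u v * v q))
      = (\<Sum>c\<in>B. (\<lambda>q. u (exponent_vector c) * exponent_vector c q))"
    using inj by (simp add: sum.reindex)
  also have "\<dots> = exponent_vector (prod_mset A) - exponent_vector (prod_mset A')"
    unfolding exponent_vector_prod_mset[OF B A] exponent_vector_prod_mset[OF B A']
      sum_subtractf[symmetric]
    by (intro sum.cong) (simp_all add: u fun_eq_iff left_diff_distrib)
  finally have "(\<Sum>v\<in>exponent_vector ` B. (\<lambda>q. u v * v q)) = 0" using eq by simp
  then have "u (exponent_vector c) = 0" if "c \<in> B" for c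
    using fun_space.independentD[OF indep _ subset_refl] B(1) that by blast
  then have "count A c = count A' c" for c
    using A A' u by (metis eq_iff_diff_eq_0 not_in_iff of_nat_eq_iff subsetD)
  then show "A = A'" by (rule multiset_eqI)
qed

definition determining_primes :: "rat set \<Rightarrow> nat set \<Rightarrow> bool" where
  "determining_primes C S \<longleftrightarrow> finite S \<and> S \<subseteq> {q. prime q} \<and>
     (\<forall>c\<in>C. \<forall>d\<in>C. (\<forall>q\<in>S. exponent_vector c q = exponent_vector d q) \<longrightarrow> \<bar>c\<bar> = \<bar>d\<bar>)"

lemma determining_primes_extend:
  assumes S: "determining_primes C S" and "card S \<le> n"
  obtains T where "determining_primes C T" "card T = n"
proof -
  have fin: "finite S" using S by (simp add: determining_primes_def)
  then have "infinite ({q::nat. prime q} - S)" using primes_infinite by (rule Diff_infinite_finite)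
  then obtain D where D: "finite D" "card D = n - card S" "D \<subseteq> {q. prime q} - S"
    using infinite_arbitrarily_large by blast
  then have "card (S \<union> D) = n" using fin assms(2) by (subst card_Un_disjoint) auto
  moreover have "determining_primes C (S \<union> D)"
    using S D(1,3) unfolding determining_primes_def by (blast intro: finite_UnI)
  ultimately show thesis using that by blast
qed

lemma obtain_mult_independent_determining_primes:
  assumes C: "finite C" "0 \<notin> C"
  obtains B S where "B \<subseteq> C" "mult_independent B" "determining_primes C S" "card S \<le> card B"
proof -
  obtain E where E: "E \<subseteq> exponent_vector ` C" "fun_space.independent E"
    and spanning: "exponent_vector ` C \<subseteq> fun_space.span E"
    by (rule fun_space.maximal_independent_subset)
  obtain B where B: "B \<subseteq> C" "inj_on exponent_vector B" "E = exponent_vector ` B"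
    using E(1) by (auto simp: subset_image_inj)
  have finB: "finite B" using B(1) C(1) finite_subset by blast
  then have "finite E" using B(3) by simp
  then obtain S where S: "card S \<le> card E"
    "determining_functionals (\<lambda>q v. v q) {q. prime q} S (fun_space.span E)"
    using linear_evaluation by (rule fun_space.obtain_determining_functionals)
  have "\<bar>c\<bar> = \<bar>d\<bar>"
    if c: "c \<in> C" and d: "d \<in> C" and eq: "\<forall>q\<in>S. exponent_vector c q = exponent_vector d q" for c d
  proof (rule abs_eq_if_exponent_vector_eq)
    have "exponent_vector c - exponent_vector d \<in> fun_space.span E"
      using c d spanning by (intro fun_space.span_diff) auto
    moreover have "\<forall>q\<in>S. (exponent_vector c - exponent_vector d) q = 0" using eq by simp
    ultimately have "\<forall>q\<in>{q. prime q}. (exponent_vector c - exponent_vector d) q = 0"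
      using S(2) unfolding determining_functionals_def by blast
    then show "exponent_vector c = exponent_vector d"
      using exponent_vector_nonprime
      by (intro ext) (metis eq_iff_diff_eq_0 mem_Collect_eq minus_apply)
  qed (use c d C(2) in auto)
  then have "determining_primes C S"
    using S(2) unfolding determining_primes_def determining_functionals_def by blast
  moreover have "mult_independent B"
    using B C finB E(2) by (intro mult_independent_if_exponent_vectors_independent) auto
  moreover have "card S \<le> card B" using S(1) B by (simp add: card_image)
  ultimately show thesis using that B(1) by blast
qed

subsection \<open>Rational lifts of residues\<close>

definition is_rational_lift :: "int \<Rightarrow> nat \<Rightarrow> rat \<Rightarrow> int \<Rightarrow> bool" where
  "is_rational_lift M K c x \<longleftrightarrow> (\<exists>a b. c = of_int a / of_nat b \<and>
     nat \<bar>a\<bar> \<le> K \<and> 0 < b \<and> b \<le> K \<and> [a = int b * x] (mod M))"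

lemma is_rational_liftE:
  assumes "is_rational_lift M K c x"
  obtains a b where "c = of_int a / of_nat b" "nat \<bar>a\<bar> \<le> K" "0 < b" "b \<le> K"
    "[a = int b * x] (mod M)"
  using assms unfolding is_rational_lift_def by blast

lemma is_rational_lift_1: "K > 0 \<Longrightarrow> is_rational_lift M K 1 1"
  unfolding is_rational_lift_def by (intro exI[of _ 1]) simp

lemma is_rational_lift_mult:
  assumes "is_rational_lift M K c x" "is_rational_lift M L d y"
  shows "is_rational_lift M (K * L) (c * d) (x * y mod M)"
proof -
  obtain a b where c: "c = of_int a / of_nat b" "nat \<bar>a\<bar> \<le> K" "0 < b" "b \<le> K"
    "[a = int b * x] (mod M)"
    using assms(1) by (rule is_rational_liftE)
  obtain a' b' where d: "d = of_int a' / of_nat b'" "nat \<bar>a'\<bar> \<le> L" "0 < b'" "b' \<le> L"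
    "[a' = int b' * y] (mod M)"
    using assms(2) by (rule is_rational_liftE)
  have "[a * a' = (int b * x) * (int b' * y)] (mod M)" using c d by (intro cong_mult)
  also have "(int b * x) * (int b' * y) = int (b * b') * (x * y)" by simp
  also have "[int (b * b') * (x * y) = int (b * b') * (x * y mod M)] (mod M)"
    by (simp add: cong_def mod_mult_right_eq)
  finally have "[a * a' = int (b * b') * (x * y mod M)] (mod M)" .
  moreover have "nat \<bar>a * a'\<bar> \<le> K * L" "b * b' \<le> K * L" "0 < b * b'"
    using c d by (auto simp: abs_mult nat_mult_distrib intro: mult_mono)
  moreover have "c * d = of_int (a * a') / of_nat (b * b')" using c d by simp
  ultimately show ?thesis unfolding is_rational_lift_def by blast
qed

lemma is_rational_lift_unique:
  assumes "is_rational_lift M K c x" "is_rational_lift M K d x" and M: "2 * int K ^ 2 < M"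
  shows "c = d"
proof -
  obtain a b where c: "c = of_int a / of_nat b" "nat \<bar>a\<bar> \<le> K" "0 < b" "b \<le> K"
    "[a = int b * x] (mod M)"
    using assms(1) by (rule is_rational_liftE)
  obtain a' b' where d: "d = of_int a' / of_nat b'" "nat \<bar>a'\<bar> \<le> K" "0 < b'" "b' \<le> K"
    "[a' = int b' * x] (mod M)"
    using assms(2) by (rule is_rational_liftE)
  have "[a * int b' = int b * x * int b'] (mod M)" by (intro cong_mult c cong_refl)
  also have "int b * x * int b' = int b' * x * int b" by simp
  also have "[int b' * x * int b = a' * int b] (mod M)"
    by (intro cong_mult cong_sym[OF d(5)] cong_refl)
  finally have "M dvd a * int b' - a' * int b" by (simp add: cong_iff_dvd_diff)
  moreover have "\<bar>a * int b'\<bar> \<le> int K ^ 2" "\<bar>a' * int b\<bar> \<le> int K ^ 2"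
    using c d by (auto simp: abs_mult power2_eq_square intro!: mult_mono)
  then have "\<bar>a * int b' - a' * int b\<bar> < M" using M by linarith
  ultimately have "a * int b' = a' * int b"
    using dvd_imp_le_int[of "a * int b' - a' * int b" M] by fastforce
  then have "(of_int a * of_nat b' :: rat) = of_int a' * of_nat b"
    by (metis of_int_mult of_int_of_nat_eq)
  then show ?thesis using c d by (simp add: frac_eq_eq)
qed

definition rational_lifts :: "int \<Rightarrow> int set \<Rightarrow> nat \<Rightarrow> rat set" where
  "rational_lifts M G K = {c. \<exists>x\<in>G. is_rational_lift M K c x}"

lemma
  assumes G: "finite G" and M: "2 * int K ^ 2 < M"
  shows finite_rational_lifts: "finite (rational_lifts M G K)"
    and card_rational_lifts_le: "card (rational_lifts M G K) \<le> card G"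
proof -
  have "\<forall>c\<in>rational_lifts M G K. \<exists>x. x \<in> G \<and> is_rational_lift M K c x"
    by (auto simp: rational_lifts_def)
  then obtain residue where residue:
    "\<And>c. c \<in> rational_lifts M G K \<Longrightarrow> residue c \<in> G \<and> is_rational_lift M K c (residue c)"
    by metis
  have "inj_on residue (rational_lifts M G K)"
    using residue is_rational_lift_unique[OF _ _ M] by (metis inj_onI)
  moreover have "residue ` rational_lifts M G K \<subseteq> G" using residue by blast
  ultimately show "finite (rational_lifts M G K)" "card (rational_lifts M G K) \<le> card G"
    using G by (auto intro: inj_on_finite card_inj_on_le)
qed

lemma zero_notin_rational_lifts:
  assumes p: "prime p" and K: "K < p" and G: "G \<subseteq> {0<..<int p}"
  shows "0 \<notin> rational_lifts (int p) G K"
proof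
  assume "0 \<in> rational_lifts (int p) G K"
  then obtain b x where b: "0 < b" "b \<le> K" and x: "x \<in> G" and "[0 = int b * x] (mod int p)"
    by (auto simp: rational_lifts_def is_rational_lift_def)
  then have "int p dvd int b * x" by (metis cong_0_iff cong_sym)
  then have "p dvd b \<or> int p dvd x" using p by (simp add: prime_dvd_mult_iff)
  moreover have "\<not> p dvd b" using b K by (intro nat_dvd_not_less) auto
  moreover have "\<not> int p dvd x" using x G by (intro zdvd_not_zless) auto
  ultimately show False by blast
qed

lemma numer_denom_le_if_in_rational_lifts:
  assumes "c \<in> rational_lifts M G K" "c \<noteq> 0"
  shows "numer c \<le> K" "denom c \<le> K"
proof -
  obtain a b where ab: "c = of_int a / of_nat b" "nat \<bar>a\<bar> \<le> K" "0 < b" "b \<le> K"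
    using assms(1) by (auto simp: rational_lifts_def is_rational_lift_def)
  then have "\<bar>c\<bar> = of_nat (nat \<bar>a\<bar>) / of_nat b" by (simp add: abs_divide)
  then have "numer c dvd nat \<bar>a\<bar>" "denom c dvd b" using ab(3) by (rule numer_denom_dvd)+
  moreover have "nat \<bar>a\<bar> > 0" using ab(1) assms(2) by auto
  ultimately show "numer c \<le> K" "denom c \<le> K" using ab dvd_imp_le le_trans by blast+
qed

definition submonoid_mod :: "int \<Rightarrow> int set \<Rightarrow> bool" where
  "submonoid_mod M G \<longleftrightarrow> 1 \<in> G \<and> (\<forall>x\<in>G. \<forall>y\<in>G. x * y mod M \<in> G)"

lemma prod_mset_in_rational_lifts:
  assumes "submonoid_mod M G" and "set_mset A \<subseteq> rational_lifts M G K"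
  shows "prod_mset A \<in> rational_lifts M G (K ^ size A)"
  using assms(2)
proof (induction A)
  case empty
  show ?case using assms(1) is_rational_lift_1 by (auto simp: rational_lifts_def submonoid_mod_def)
next
  case (add c A)
  then obtain x y where "x \<in> G" "is_rational_lift M K c x" "y \<in> G"
    "is_rational_lift M (K ^ size A) (prod_mset A) y"
    by (auto simp: rational_lifts_def)
  then show ?case
    using assms(1) is_rational_lift_mult by (fastforce simp: rational_lifts_def submonoid_mod_def)
qed

text \<open>Allowing the factor \<open>1\<close> turns the monomials of degree at most \<open>r\<close> into those of degree
  exactly \<open>r\<close>.\<close>

lemma
  assumes "mult_independent B"
  shows one_notin_if_mult_independent: "1 \<notin> B"
    and inj_on_prod_mset_multisets_of_size: "inj_on prod_mset (multisets_of_size (insert 1 B) r)"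
proof -
  have eqI: "A = A'" if "set_mset A \<subseteq> B" "set_mset A' \<subseteq> B" "prod_mset A = prod_mset A'" for A A'
    using assms that by (auto simp: mult_independent_def dest: inj_onD)
  show "1 \<notin> B" using eqI[of "{#1#}" "{#}"] by auto
  show "inj_on prod_mset (multisets_of_size (insert 1 B) r)"
  proof (rule inj_onI)
    fix A A' assume A: "A \<in> multisets_of_size (insert 1 B) r"
      and A': "A' \<in> multisets_of_size (insert 1 B) r" and eq: "prod_mset A = prod_mset A'"
    obtain m X where X: "A = X + replicate_mset m 1" "X \<in> multisets_of_size B (r - m)" "m \<le> r"
      using A multisets_of_size_insert[OF \<open>1 \<notin> B\<close>] by auto
    obtain m' X' where
      X': "A' = X' + replicate_mset m' 1" "X' \<in> multisets_of_size B (r - m')" "m' \<le> r"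
      using A' multisets_of_size_insert[OF \<open>1 \<notin> B\<close>] by auto
    have "X = X'" using X X' eq by (intro eqI) (simp_all add: multisets_of_size_def)
    moreover from this have "m = m'" using X X' by (simp add: multisets_of_size_def)
    ultimately show "A = A'" using X X' by simp
  qed
qed

lemma binomial_le_card_if_mult_independent:
  assumes B: "finite B" "mult_independent B" "B \<subseteq> rational_lifts M G K"
    and G: "finite G" "submonoid_mod M G"
    and K: "K > 0" "2 * int K ^ (2 * r) < M"
  shows "(r + card B) choose card B \<le> card G"
proof -
  let ?monomials = "multisets_of_size (insert 1 B) r"
  have bound: "2 * int (K ^ r) ^ 2 < M" using K(2) by (simp add: power_mult[symmetric] mult.commute)
  have one: "1 \<in> rational_lifts M G K"
    using G(2) is_rational_lift_1[OF K(1)] by (auto simp: rational_lifts_def submonoid_mod_def)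
  have "prod_mset ` ?monomials \<subseteq> rational_lifts M G (K ^ r)"
  proof clarify
    fix A assume "A \<in> ?monomials"
    then have "set_mset A \<subseteq> rational_lifts M G K" "size A = r"
      using B(3) one by (auto simp: multisets_of_size_def)
    then show "prod_mset A \<in> rational_lifts M G (K ^ r)"
      using prod_mset_in_rational_lifts[OF G(2)] by metis
  qed
  then have "card ?monomials \<le> card (rational_lifts M G (K ^ r))"
    using inj_on_prod_mset_multisets_of_size[OF B(2)] finite_rational_lifts[OF G(1) bound]
    by (intro card_inj_on_le)
  also have "\<dots> \<le> card G" by (rule card_rational_lifts_le[OF G(1) bound])
  also have "card ?monomials = (r + card B) choose card B"
    using B(1) one_notin_if_mult_independent[OF B(2)] binomial_symmetric[of "card B" "r + card B"]
    by (simp add: card_multisets_of_size add.commute)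
  finally show ?thesis .
qed

lemma obtain_determining_primes_rational_lifts:
  assumes G: "finite G" "submonoid_mod M G" and K: "K > 0" "2 * int K ^ (2 * r) < M"
    and lifts: "finite (rational_lifts M G K)" "0 \<notin> rational_lifts M G K"
  obtains S where "determining_primes (rational_lifts M G K) S"
    "(r + card S) choose card S \<le> card G"
proof -
  obtain B S where B: "B \<subseteq> rational_lifts M G K" "mult_independent B"
    and S: "determining_primes (rational_lifts M G K) S" "card S \<le> card B"
    using lifts by (rule obtain_mult_independent_determining_primes)
  have "(r + card S) choose card S = (r + card S) choose r"
    using binomial_symmetric[of r "r + card S"] by simp
  also have "\<dots> \<le> (r + card B) choose r" using S(2) by (intro binomial_right_mono) simp
  also have "\<dots> = (r + card B) choose card B"
    using binomial_symmetric[of r "r + card B"] by simp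
  also have "\<dots> \<le> card G"
    using finite_subset[OF B(1) lifts(1)] B(2,1) G K by (rule binomial_le_card_if_mult_independent)
  finally show thesis using that S(1) by blast
qed

subsection \<open>Smooth numbers\<close>

definition smooth_upto :: "nat \<Rightarrow> nat set \<Rightarrow> nat set" where
  "smooth_upto k I = {n. 0 < n \<and> n \<le> k \<and> prime_factors n \<subseteq> I}"

lemma finite_smooth_upto [simp]: "finite (smooth_upto k I)"
  by (rule finite_subset[of _ "{..k}"]) (auto simp: smooth_upto_def)

definition smooth_part :: "nat set \<Rightarrow> nat \<Rightarrow> nat" where
  "smooth_part S n = prod_mset (filter_mset (\<lambda>q. q \<in> S) (prime_factorization n))"

lemma prime_factorization_smooth_part:
  "prime_factorization (smooth_part S n) = filter_mset (\<lambda>q. q \<in> S) (prime_factorization n)"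
  unfolding smooth_part_def by (rule prime_factorization_prod_mset_primes) auto

lemma smooth_part_dvd: "smooth_part S n dvd n"
proof (cases "n = 0")
  case False
  have "smooth_part S n dvd prod_mset (prime_factorization n)"
    unfolding smooth_part_def by (intro prod_mset_subset_imp_dvd) simp
  then show ?thesis using False by simp
qed simp

lemma smooth_part_in_smooth_upto:
  assumes "n > 0" "n \<le> k"
  shows "smooth_part S n \<in> smooth_upto k S"
proof -
  have "smooth_part S n > 0" "smooth_part S n \<le> n"
    using smooth_part_dvd[of S n] assms(1) by (auto intro: dvd_pos_nat dvd_imp_le)
  then show ?thesis using assms(2) by (auto simp: smooth_upto_def prime_factorization_smooth_part)
qed

lemma prod_mset_mono_nat:
  fixes f g :: "'a \<Rightarrow> nat"
  assumes "\<And>x. x \<in># A \<Longrightarrow> f x \<le> g x"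
  shows "prod_mset (image_mset f A) \<le> prod_mset (image_mset g A)"
  using assms by (induction A) (auto intro!: mult_le_mono)

lemma card_smooth_upto_image_ge:
  assumes inj: "inj_on f I" and prime: "\<And>q. q \<in> I \<Longrightarrow> prime (f q)" and le: "\<And>q. q \<in> I \<Longrightarrow> f q \<le> q"
  shows "card (smooth_upto k I) \<le> card (smooth_upto k (f ` I))"
proof -
  define g where "g n = prod_mset (image_mset f (prime_factorization n))" for n
  have factorization: "prime_factorization (g n) = image_mset f (prime_factorization n)"
    if "n \<in> smooth_upto k I" for n
    unfolding g_def using that prime
    by (intro prime_factorization_prod_mset_primes) (auto simp: smooth_upto_def)
  have "inj_on g (smooth_upto k I)"
  proof (rule inj_onI)
    fix m n assume m: "m \<in> smooth_upto k I" and n: "n \<in> smooth_upto k I" and eq: "g m = g n"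
    have "image_mset f (prime_factorization m) = image_mset f (prime_factorization n)"
      using factorization[OF m] factorization[OF n] eq by simp
    moreover have "q = q'"
      if "q \<in># prime_factorization m" "q' \<in># prime_factorization n" "f q = f q'" for q q'
      using inj_onD[OF inj that(3)] that(1,2) m n by (auto simp: smooth_upto_def)
    ultimately have "prime_factorization m = prime_factorization n"
      by (rule multiset.inj_map_strong[rotated])
    then show "m = n" using m n by (simp add: smooth_upto_def prime_factorization_unique)
  qed
  moreover have "g n \<in> smooth_upto k (f ` I)" if n: "n \<in> smooth_upto k I" for n
  proof -
    have "g n \<le> prod_mset (image_mset id (prime_factorization n))"
      unfolding g_def using n le by (intro prod_mset_mono_nat) (auto simp: smooth_upto_def)
    moreover have "0 \<notin> f ` I" using prime not_prime_0 by (metis imageE)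
    then have "g n \<noteq> 0" using n by (auto simp: g_def smooth_upto_def)
    ultimately show ?thesis
      using n factorization[OF n] by (auto simp: smooth_upto_def)
  qed
  ultimately show ?thesis by (intro card_inj_on_le) auto
qed

lemma enumerate_card_le:
  fixes N :: "nat set"
  assumes "infinite N" "A \<subseteq> N" "b \<in> N" "\<And>a. a \<in> A \<Longrightarrow> a < b"
  shows "enumerate N (card A) \<le> b"
proof -
  obtain n where n: "enumerate N n = b" using enumerate_Ex[OF assms(1,3)] by blast
  have "A \<subseteq> enumerate N ` {..<n}"
  proof
    fix a assume "a \<in> A"
    then obtain m where m: "enumerate N m = a" using enumerate_Ex[OF assms(1)] assms(2) by blast
    then have "m < n" using assms(1,4) \<open>a \<in> A\<close> n by (metis enumerate_mono_iff)
    then show "a \<in> enumerate N ` {..<n}" using m by blast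
  qed
  then have "card A \<le> card {..<n}" by (intro surj_card_le) auto
  then show ?thesis using assms(1) n by (metis card_lessThan enumerate_mono_le_iff)
qed

lemma ex_decreasing_bij_betw_initial_segment:
  fixes N :: "nat set"
  assumes "infinite N" "finite A" "A \<subseteq> N"
  shows "\<exists>f. bij_betw f A (enumerate N ` {..<card A}) \<and> (\<forall>a\<in>A. f a \<le> a)"
  using assms(2,3)
proof (induction A rule: finite_linorder_max_induct)
  case empty
  then show ?case by (simp add: bij_betw_def)
next
  case (insert b A)
  then obtain f where f: "bij_betw f A (enumerate N ` {..<card A})" "\<forall>a\<in>A. f a \<le> a"
    by auto
  have b: "b \<notin> A" using insert.hyps by blast
  define g where "g = f(b := enumerate N (card A))"
  have "bij_betw g A (enumerate N ` {..<card A})"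
    using f(1) b by (subst bij_betw_cong[of A g f]) (auto simp: g_def)
  moreover have "g b \<notin> enumerate N ` {..<card A}"
    using inj_enumerate[OF assms(1)] by (auto simp: g_def dest: injD)
  ultimately have "bij_betw g (A \<union> {b}) (enumerate N ` {..<card A} \<union> {g b})"
    using b by (intro notIn_Un_bij_betw)
  then have "bij_betw g (insert b A) (enumerate N ` {..<card (insert b A)})"
    using b insert.hyps(1) by (simp add: lessThan_Suc g_def)
  moreover have "enumerate N (card A) \<le> b"
    using insert.prems insert.hyps(2) assms(1) by (intro enumerate_card_le) auto
  then have "\<forall>a\<in>insert b A. g a \<le> a" using f(2) by (simp add: g_def)
  ultimately show ?case by blast
qed

lemma card_smooth_upto_first_primes_le:
  "card (smooth_upto k (enumerate {q. prime q} ` {..<m})) \<le> Psi_prime (real k) m"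
proof (cases m)
  case 0
  have "smooth_upto k {} \<subseteq> {1}"
    by (auto simp: smooth_upto_def prime_factorization_empty_iff)
  then have "card (smooth_upto k {}) \<le> card {1::nat}" by (intro card_mono) auto
  then show ?thesis using 0 by (simp add: Psi_prime_def)
next
  case (Suc j)
  define T where "T = {n::nat. n > 0 \<and> real n \<le> real k \<and>
    (\<forall>q. prime q \<and> q dvd n \<longrightarrow> real q \<le> real (nth_prime m))}"
  have "smooth_upto k (enumerate {q. prime q} ` {..<m}) \<subseteq> T"
  proof
    fix n assume n: "n \<in> smooth_upto k (enumerate {q. prime q} ` {..<m})"
    have "q \<le> nth_prime m" if "prime q" "q dvd n" for q
    proof -
      have "q \<in> prime_factors n" using that n by (simp add: in_prime_factors_iff smooth_upto_def)
      then obtain i where "i < m" "q = enumerate {q. prime q} i"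
        using n by (auto simp: smooth_upto_def)
      then show ?thesis using Suc primes_infinite by (simp add: nth_prime_def)
    qed
    then show "n \<in> T" using n by (simp add: T_def smooth_upto_def)
  qed
  moreover have "finite T" by (rule finite_subset[of _ "{..k}"]) (auto simp: T_def)
  ultimately show ?thesis using Suc by (simp add: Psi_prime_def Psi_def T_def card_mono)
qed

lemma card_smooth_upto_le:
  assumes "finite I" and prime: "\<And>q. q \<in> I \<Longrightarrow> prime q"
  shows "card (smooth_upto k I) \<le> Psi_prime (real k) (card I)"
proof -
  obtain f where f: "bij_betw f I (enumerate {q. prime q} ` {..<card I})" "\<forall>q\<in>I. f q \<le> q"
    using ex_decreasing_bij_betw_initial_segment[OF primes_infinite assms(1)] prime by blast
  have "prime (f q)" if "q \<in> I" for q
    using bij_betwE[OF f(1)] that enumerate_in_set[OF primes_infinite] by fastforce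
  then have "card (smooth_upto k I) \<le> card (smooth_upto k (f ` I))"
    using f by (intro card_smooth_upto_image_ge) (auto simp: bij_betw_def)
  also have "f ` I = enumerate {q. prime q} ` {..<card I}" using f(1) by (simp add: bij_betw_def)
  also have "card (smooth_upto k \<dots>) \<le> Psi_prime (real k) (card I)"
    by (rule card_smooth_upto_first_primes_le)
  finally show ?thesis .
qed

lemma sum_Pow_card:
  assumes "finite S"
  shows "(\<Sum>I\<in>Pow S. g (card I)) = (\<Sum>i = 0..card S. of_nat (card S choose i) * g i :: 'a::semiring_1)"
proof -
  have "(\<Sum>I\<in>Pow S. g (card I)) = (\<Sum>i = 0..card S. \<Sum>I\<in>{I \<in> Pow S. card I = i}. g (card I))"
    using assms by (intro sum.group[symmetric]) (auto simp: card_mono)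
  also have "\<dots> = (\<Sum>i = 0..card S. of_nat (card S choose i) * g i)"
    using assms by (intro sum.cong) (simp_all add: n_subsets)
  finally show ?thesis .
qed

lemma coprime_smooth_pairs_subset:
  "{(u, v). u \<in> smooth_upto k S \<and> v \<in> smooth_upto k S \<and> coprime u v}
    \<subseteq> (\<Union>I\<in>Pow S. smooth_upto k I \<times> smooth_upto k (S - I))"
proof clarify
  fix u v assume uv: "u \<in> smooth_upto k S" "v \<in> smooth_upto k S" "coprime u v"
  have "prime_factors v \<inter> prime_factors u = {}"
    using uv(3) by (auto simp: in_prime_factors_iff) (metis coprime_common_divisor not_prime_unit)
  then have "u \<in> smooth_upto k (prime_factors u)" "v \<in> smooth_upto k (S - prime_factors u)"
    "prime_factors u \<in> Pow S"
    using uv by (auto simp: smooth_upto_def)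
  then show "(u, v) \<in> (\<Union>I\<in>Pow S. smooth_upto k I \<times> smooth_upto k (S - I))" by blast
qed

lemma card_coprime_smooth_pairs_le:
  assumes "finite S" and prime: "\<And>q. q \<in> S \<Longrightarrow> prime q"
  shows "card {(u, v). u \<in> smooth_upto k S \<and> v \<in> smooth_upto k S \<and> coprime u v}
    \<le> Phi_tilde k (card S)"
    (is "card ?C \<le> _")
proof -
  have "card ?C \<le> card (\<Union>I\<in>Pow S. smooth_upto k I \<times> smooth_upto k (S - I))"
    using assms(1) by (intro card_mono coprime_smooth_pairs_subset) auto
  also have "\<dots> \<le> (\<Sum>I\<in>Pow S. card (smooth_upto k I \<times> smooth_upto k (S - I)))"
    using assms(1) by (intro card_UN_le) auto
  also have "\<dots> \<le> (\<Sum>I\<in>Pow S. Psi_prime (real k) (card I) * Psi_prime (real k) (card S - card I))"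
  proof (rule sum_mono)
    fix I assume I: "I \<in> Pow S"
    then have "finite I" using assms(1) finite_subset by blast
    then have "card (S - I) = card S - card I" using I by (intro card_Diff_subset) auto
    then show "card (smooth_upto k I \<times> smooth_upto k (S - I))
        \<le> Psi_prime (real k) (card I) * Psi_prime (real k) (card S - card I)"
      using card_smooth_upto_le[of I k] card_smooth_upto_le[of "S - I" k] assms \<open>finite I\<close> I
      by (auto simp: card_cartesian_product intro: mult_mono)
  qed
  also have "\<dots> = Phi_tilde k (card S)"
    using sum_Pow_card[OF assms(1), of "\<lambda>i. Psi_prime (real k) i * Psi_prime (real k) (card S - i)"]
    by (simp add: Phi_tilde_def mult.assoc)
  finally show ?thesis .
qed

lemma card_image_le_if_factors_through:
  assumes "finite (f ` A)" "\<And>x y. x \<in> A \<Longrightarrow> y \<in> A \<Longrightarrow> f x = f y \<Longrightarrow> g x = g y"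
  shows "card (g ` A) \<le> card (f ` A)"
proof -
  obtain h where "\<forall>x. x \<in> A \<longrightarrow> g x = h (f x)"
    using function_factors_left_gen[of "\<lambda>x. x \<in> A" f g] assms(2) by blast
  then have "g ` A = h ` f ` A" by force
  then show ?thesis using card_image_le[OF assms(1)] by metis
qed

lemma card_abs_rationals_le_Phi_tilde:
  assumes T: "determining_primes C T" and "0 \<notin> C"
    and bound: "\<And>c. c \<in> C \<Longrightarrow> numer c \<le> k" "\<And>c. c \<in> C \<Longrightarrow> denom c \<le> k"
  shows "card (abs ` C) \<le> Phi_tilde k (card T)"
proof -
  define parts where "parts c = (smooth_part T (numer c), smooth_part T (denom c))" for c
  define pairs where "pairs = {(u, v). u \<in> smooth_upto k T \<and> v \<in> smooth_upto k T \<and> coprime u v}"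
  have "finite pairs"
    by (rule finite_subset[of _ "smooth_upto k T \<times> smooth_upto k T"]) (auto simp: pairs_def)
  have parts: "parts ` C \<subseteq> pairs"
  proof
    fix z assume "z \<in> parts ` C"
    then obtain c where c: "c \<in> C" "z = parts c" by blast
    then have "numer c > 0" using assms(2) numer_pos_iff by blast
    moreover have "coprime (smooth_part T (numer c)) (smooth_part T (denom c))"
      using coprime_numer_denom smooth_part_dvd coprime_divisors by blast
    ultimately show "z \<in> pairs"
      using c bound denom_pos by (auto simp: pairs_def parts_def smooth_part_in_smooth_upto)
  qed
  have "\<bar>c\<bar> = \<bar>d\<bar>" if "c \<in> C" "d \<in> C" "parts c = parts d" for c d
  proof -
    have "exponent_vector c q = of_nat (count (prime_factorization (fst (parts c))) q)
        - of_nat (count (prime_factorization (snd (parts c))) q)" if "q \<in> T" for c q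
      using that by (simp add: exponent_vector_def parts_def prime_factorization_smooth_part)
    then have "\<forall>q\<in>T. exponent_vector c q = exponent_vector d q" using that(3) by simp
    then show ?thesis using T that(1,2) unfolding determining_primes_def by blast
  qed
  then have "card (abs ` C) \<le> card (parts ` C)"
    using parts \<open>finite pairs\<close> finite_subset by (intro card_image_le_if_factors_through) blast+
  also have "\<dots> \<le> card pairs" using parts \<open>finite pairs\<close> by (rule card_mono[rotated])
  also have "\<dots> \<le> Phi_tilde k (card T)"
    unfolding pairs_def using T
    by (intro card_coprime_smooth_pairs_le) (auto simp: determining_primes_def)
  finally show ?thesis .
qed

subsection \<open>Heights\<close>

lemma integer_height_cong:
  assumes "[x = y] (mod int p)"
  shows "integer_height p x = integer_height p y"
proof -
  have "[a = x] (mod int p) \<longleftrightarrow> [a = y] (mod int p)" for a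
    using assms cong_trans cong_sym by blast
  then show ?thesis by (simp add: integer_height_def)
qed

lemma integer_height_minus: "integer_height p (- x) = integer_height p x"
proof -
  have "(\<exists>a. [a = - x] (mod int p) \<and> h = nat \<bar>a\<bar>) \<longleftrightarrow> (\<exists>a. [a = x] (mod int p) \<and> h = nat \<bar>a\<bar>)" for h
    by (metis abs_minus_cancel cong_minus_minus_iff minus_minus)
  then show ?thesis by (simp add: integer_height_def)
qed

lemma integer_height_eq_if_abs_lift_eq:
  assumes p: "prime p" and k: "k < p"
    and lifts: "is_rational_lift (int p) k c x" "is_rational_lift (int p) k d y" and eq: "\<bar>c\<bar> = \<bar>d\<bar>"
  shows "integer_height p x = integer_height p y"
proof -
  obtain a b where c: "c = of_int a / of_nat b" "0 < b" "b \<le> k" "[a = int b * x] (mod int p)"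
    using lifts(1) by (rule is_rational_liftE)
  obtain a' b' where d: "d = of_int a' / of_nat b'" "0 < b'" "b' \<le> k"
    "[a' = int b' * y] (mod int p)"
    using lifts(2) by (rule is_rational_liftE)
  have "coprime n p" if "0 < n" "n \<le> k" for n
  proof -
    have "\<not> p dvd n" using that k by (intro nat_dvd_not_less) auto
    then show ?thesis using prime_imp_coprime[OF p] by (simp add: coprime_commute)
  qed
  then have coprime: "coprime (int b * int b') (int p)" using c d by simp
  have x: "[a * int b' = int b * int b' * x] (mod int p)"
    using cong_mult[OF c(4) cong_refl, of "int b'"] by (simp add: ac_simps)
  have y: "[a' * int b = int b * int b' * y] (mod int p)"
    using cong_mult[OF d(4) cong_refl, of "int b"] by (simp add: ac_simps)
  have "(of_int \<bar>a * int b'\<bar> :: rat) = of_int \<bar>a' * int b\<bar>"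
    using c d eq by (simp add: abs_mult frac_eq_eq)
  then have "\<bar>a * int b'\<bar> = \<bar>a' * int b\<bar>" by (simp only: of_int_eq_iff)
  then consider "a * int b' = a' * int b" | "a * int b' = - (a' * int b)" by linarith
  then show ?thesis
  proof cases
    case 1
    then have "[int b * int b' * x = int b * int b' * y] (mod int p)"
      using x y cong_sym cong_trans by metis
    then show ?thesis using coprime by (intro integer_height_cong) (simp only: cong_mult_lcancel)
  next
    case 2
    have "[- (a' * int b) = int b * int b' * (- y)] (mod int p)"
      using y by (simp add: cong_minus_minus_iff)
    then have "[int b * int b' * x = int b * int b' * (- y)] (mod int p)"
      using x 2 cong_sym cong_trans by metis
    then have "integer_height p x = integer_height p (- y)"
      using coprime by (intro integer_height_cong) (simp only: cong_mult_lcancel)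
    then show ?thesis by (simp add: integer_height_minus)
  qed
qed

lemma ex_rational_lift_if_rational_height_le:
  assumes "rational_height p x \<le> k"
  shows "\<exists>c. is_rational_lift (int p) k c x"
proof -
  have "\<exists>h (a::int) (b::nat). b > 0 \<and> [a = int b * x] (mod int p) \<and> h = max (nat \<bar>a\<bar>) b"
    by (intro exI[of _ "max (nat \<bar>x\<bar>) 1"] exI[of _ x] exI[of _ "1::nat"]) simp
  from LeastI_ex[OF this] obtain a b where
    "b > 0" "[a = int b * x] (mod int p)" "rational_height p x = max (nat \<bar>a\<bar>) b"
    unfolding rational_height_def by blast
  then show ?thesis using assms unfolding is_rational_lift_def by auto
qed

lemma card_integer_height_le_card_abs_rational_lifts:
  assumes p: "prime p" and k: "k < p" and fin: "finite (rational_lifts (int p) G k)"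
  shows "card (integer_height p ` {x \<in> G. rational_height p x \<le> k})
    \<le> card (abs ` rational_lifts (int p) G k)"
proof -
  define V where "V = {x \<in> G. rational_height p x \<le> k}"
  have "\<forall>x\<in>V. \<exists>c. is_rational_lift (int p) k c x"
    using ex_rational_lift_if_rational_height_le by (simp add: V_def)
  then obtain c where c: "\<And>x. x \<in> V \<Longrightarrow> is_rational_lift (int p) k (c x) x"
    by metis
  then have sub: "(\<lambda>x. \<bar>c x\<bar>) ` V \<subseteq> abs ` rational_lifts (int p) G k"
    by (auto simp: rational_lifts_def V_def)
  have "finite ((\<lambda>x. \<bar>c x\<bar>) ` V)" using finite_subset[OF sub] fin by simp
  then have "card (integer_height p ` V) \<le> card ((\<lambda>x. \<bar>c x\<bar>) ` V)"
    using integer_height_eq_if_abs_lift_eq[OF p k c c] by (rule card_image_le_if_factors_through)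
  also have "\<dots> \<le> card (abs ` rational_lifts (int p) G k)" using sub fin by (intro card_mono) auto
  finally show ?thesis by (simp add: V_def)
qed

lemma
  assumes "prime p" "t dvd p - 1"
  shows card_subgroup_of_order: "card (subgroup_of_order p t) = t"
    and subgroup_of_order_subset: "subgroup_of_order p t \<subseteq> {0<..<int p}"
    and submonoid_mod_subgroup_of_order: "submonoid_mod (int p) (subgroup_of_order p t)"
proof -
  have G: "subgroup (subgroup_of_order p t) (mult_of (residue_ring (int p)))
      \<and> card (subgroup_of_order p t) = t"
    unfolding subgroup_of_order_def by (rule theI'[OF ex1_subgroup_of_order[OF assms]])
  then show "card (subgroup_of_order p t) = t" by simp
  interpret subgroup "subgroup_of_order p t" "mult_of (residue_ring (int p))" using G by simp
  show "subgroup_of_order p t \<subseteq> {0<..<int p}"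
    using subset by (auto simp: residue_ring_def)
  show "submonoid_mod (int p) (subgroup_of_order p t)"
    using one_closed m_closed by (simp add: submonoid_mod_def residue_ring_def)
qed

lemma le_s1I:
  assumes "(r1 p k + m) choose m \<le> t" "r1 p k > 0"
  shows "m \<le> s1 p k t"
proof -
  have "s' \<le> t" if "(r1 p k + s') choose s' \<le> t" for s'
  proof -
    have "Suc s' choose s' \<le> (r1 p k + s') choose s'"
      using assms(2) by (intro binomial_right_mono) simp
    then show ?thesis using that by simp
  qed
  then have "{s'. (r1 p k + s') choose s' \<le> t} \<subseteq> {..t}" by blast
  then have "finite {s'. (r1 p k + s') choose s' \<le> t}" using finite_atMost by (rule finite_subset)
  then show ?thesis unfolding s1_def using assms(1) by (intro Max_ge) simp_all
qed

lemma
  assumes "1 < k" and "real k \<le> sqrt (real p / 2)"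
  shows r1_pos: "r1 p k > 0" and two_mult_power_r1_less: "odd p \<Longrightarrow> 2 * k ^ (2 * r1 p k) < p"
proof -
  have sq: "real k ^ 2 \<le> real p / 2" using power_mono[OF assms(2), of 2] by simp
  have k: "ln (real k) > 0" "real k ^ 2 > 0" using assms(1) by simp_all
  then have p: "real p / 2 > 0" using sq by linarith
  have "ln (real k ^ 2) \<le> ln (real p / 2)" using sq k p by simp
  then have "2 * ln (real k) \<le> ln (real p / 2)" using assms(1) by (simp add: ln_realpow)
  then have quotient: "ln (real p / 2) / (2 * ln (real k)) \<ge> 1" using k(1) by simp
  then show "r1 p k > 0" unfolding r1_def by simp
  have "real (r1 p k) \<le> ln (real p / 2) / (2 * ln (real k))"
    unfolding r1_def using quotient by (simp add: of_nat_floor)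
  then have "ln (real k ^ (2 * r1 p k)) \<le> ln (real p / 2)"
    using k(1) assms(1) by (simp add: ln_realpow field_simps)
  then have "real k ^ (2 * r1 p k) \<le> real p / 2" using assms(1) p by simp
  then have "real (2 * k ^ (2 * r1 p k)) \<le> real p" by simp
  then have "2 * k ^ (2 * r1 p k) \<le> p" by (simp only: of_nat_le_iff)
  then show "2 * k ^ (2 * r1 p k) < p" if "odd p"
    using that by (metis dvd_triv_left le_neq_implies_less)
qed

lemma card_integer_height_le_Phi_tilde:
  assumes p: "prime p" and G: "G \<subseteq> {0<..<int p}" "submonoid_mod (int p) G"
    and k: "k > 0" "r > 0" "2 * k ^ (2 * r) < p"
    and s: "\<And>m. (r + m) choose m \<le> card G \<Longrightarrow> m \<le> s"
  shows "card (integer_height p ` {x \<in> G. rational_height p x \<le> k}) \<le> Phi_tilde k s"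
proof -
  define C where "C = rational_lifts (int p) G k"
  have finG: "finite G" using G(1) finite_subset by blast
  have "k \<le> k ^ (2 * r)" using k(1,2) by (intro self_le_power) auto
  then have "k < p" using k(3) by simp
  have "k ^ 2 \<le> k ^ (2 * r)" using k(1,2) by (intro power_increasing) auto
  then have "2 * k ^ 2 < p" using k(3) by simp
  then have bound: "2 * int k ^ (2 * r) < int p" "2 * int k ^ 2 < int p"
    using k(3) by (metis of_nat_less_iff of_nat_mult of_nat_numeral of_nat_power)+
  have C: "finite C" "0 \<notin> C"
    using finite_rational_lifts[OF finG bound(2)] zero_notin_rational_lifts[OF p \<open>k < p\<close> G(1)]
    by (simp_all add: C_def)
  obtain S where S: "determining_primes C S" "(r + card S) choose card S \<le> card G"
    using finG G(2) k(1) bound(1) C unfolding C_def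
    by (rule obtain_determining_primes_rational_lifts)
  obtain T where T: "determining_primes C T" "card T = s"
    using S(1) s[OF S(2)] by (rule determining_primes_extend)
  have "card (integer_height p ` {x \<in> G. rational_height p x \<le> k}) \<le> card (abs ` C)"
    using card_integer_height_le_card_abs_rational_lifts[OF p \<open>k < p\<close>] C(1) by (simp add: C_def)
  also have "\<dots> \<le> Phi_tilde k (card T)"
  proof (rule card_abs_rationals_le_Phi_tilde[OF T(1) C(2)])
    show "numer c \<le> k" "denom c \<le> k" if "c \<in> C" for c
      using numer_denom_le_if_in_rational_lifts that C(2) unfolding C_def by metis+
  qed
  finally show ?thesis using T(2) by simp
qed

theorem theorem1p6:
  fixes p t k :: nat
  assumes "prime p" and "p > 2"
    and "t > 0" and "t dvd p - 1"
    and "1 < k" and "real k \<le> sqrt (real p / 2)"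
  shows "card (integer_height p ` V1 p k t) \<le> Phi_tilde k (s1 p k t)"
  unfolding V1_def
proof (rule card_integer_height_le_Phi_tilde)
  show r: "r1 p k > 0" using assms(5,6) by (rule r1_pos)
  show "m \<le> s1 p k t" if "(r1 p k + m) choose m \<le> card (subgroup_of_order p t)" for m
    using that r by (simp add: le_s1I card_subgroup_of_order[OF assms(1,4)])
  have "odd p" using assms(1,2) by (rule prime_odd_nat)
  with assms(5,6) show "2 * k ^ (2 * r1 p k) < p" by (rule two_mult_power_r1_less)
  show "subgroup_of_order p t \<subseteq> {0<..<int p}"
    using assms(1,4) by (rule subgroup_of_order_subset)
  show "submonoid_mod (int p) (subgroup_of_order p t)"
    using assms(1,4) by (rule submonoid_mod_subgroup_of_order)
qed (use assms in auto)

end
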